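(* Let $X$ be a Banach lattice and let $(X_k)$ be a sequence of closed non-zero subspaces of $X$ which is a Schauder decomposition of $[X_k]$. The following are equivalent: (1) $(X_k)$ is absolute, i.e. there exists a constant $A\ge1$ such that $\bigl\|\sum_{k=1}^m|x_k|\bigr\|\le A\bigl\|\sum_{k=1}^mx_k\bigr\|$ for any $m\in\mathbb N$ and any $x_1\in X_1,\dots,x_m\in X_m$; (2) for every sequence $(x_k)$ with $x_k\in X_k$ for all $k$, norm convergence of $\sum_{k=1}^\infty x_k$ implies norm convergence of $\sum_{k=1}^\infty|x_k|$; (3) for every sequence $(x_k)$ with $x_k\in X_k$ for all $k$, if $\sum_{k=1}^\infty x_k$ converges in norm then the sequence $\bigl(\sum_{k=1}^m|x_k|\bigr)_m$ is order bounded in $X$; (4) for every sequence $(x_k)$ with $x_k\in X_k$ for all $k$, if $\sum_{k=1}^\infty x_k$ converges in norm then the sequence $\bigl(\sum_{k=1}^m|x_k|\bigr)_m$ is norm bounded.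
   Context: $[X_k]$ denotes the closed linear span of $\bigcup_kX_k$. $(X_k)$ is a Schauder decomposition of $[X_k]$ if every $x\in[X_k]$ has a unique expansion $x=\sum_{k=1}^\infty x_k$ with $x_k\in X_k$, where the series converges in norm. The subspaces $X_k$ and $[X_k]$ need not be sublattices. *)

theory Defs
  imports "HOL-Analysis.Analysis" "HOL-Library.Lattice_Algebras"
begin

(* Real Banach lattices.  Since |(|x|)| = |x|, the norm axiom also gives norm |x| = norm x. *)
class banach_lattice = banach + ordered_real_vector + lattice_ab_group_add_abs +
  assumes norm_mono_abs: "\<bar>x\<bar> \<le> \<bar>y\<bar> \<Longrightarrow> norm x \<le> norm y"

instance real :: banach_lattice
  by standard simp

definition order_bounded :: "'a::order set \<Rightarrow> bool" where
  "order_bounded S \<longleftrightarrow> (\<exists>a b. S \<subseteq> {a..b})"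

(* Sequences of subspaces are indexed from 0. *)
definition closed_linear_span :: "(nat \<Rightarrow> 'a::real_normed_vector set) \<Rightarrow> 'a set" where
  "closed_linear_span X = closure (span (\<Union>k. X k))"

definition schauder_decomposition :: "(nat \<Rightarrow> 'a::real_normed_vector set) \<Rightarrow> 'a set \<Rightarrow> bool" where
  "schauder_decomposition X Y \<longleftrightarrow> (\<forall>y\<in>Y. \<exists>!x. (\<forall>k. x k \<in> X k) \<and> x sums y)"

definition absolute_decomposition :: "(nat \<Rightarrow> 'a::banach_lattice set) \<Rightarrow> bool" where
  "absolute_decomposition X \<longleftrightarrow>
     (\<exists>A::real. A \<ge> 1 \<and>
        (\<forall>m x. (\<forall>k<m. x k \<in> X k) \<longrightarrow>
           norm (\<Sum>k<m. \<bar>x k\<bar>) \<le> A * norm (\<Sum>k<m. x k)))"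

end

theory Submission
  imports Defs
begin

text \<open>
  The step from pointwise norm boundedness to absoluteness is a uniform boundedness argument for
  \<open>p y = (SUP m. norm (\<Sum>k<m. \<bar>y\<^sub>k\<bar>))\<close>, where \<open>y = (\<Sum>k. y\<^sub>k)\<close> is the expansion of \<open>y\<close>.
  Continuity of the coordinate maps is not needed: uniqueness of expansions makes \<open>p\<close>
  countably subadditive, and by Zabreiko's lemma a countably subadditive seminorm on a Banach
  space is continuous.
\<close>

section \<open>Zabreiko's lemma\<close>

lemma subspace_closure:
  fixes S :: "'a::real_normed_vector set"
  assumes "subspace S"
  shows "subspace (closure S)"
  unfolding subspace_def
proof (intro conjI ballI allI)
  show "0 \<in> closure S"
    using assms closure_subset subspace_0 by blast
next
  fix x y assume "x \<in> closure S" "y \<in> closure S"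
  then obtain f g where "\<And>n. f n \<in> S" "f \<longlonglongrightarrow> x" "\<And>n. g n \<in> S" "g \<longlonglongrightarrow> y"
    unfolding closure_sequential by blast
  then have "\<forall>n. f n + g n \<in> S" "(\<lambda>n. f n + g n) \<longlonglongrightarrow> x + y"
    using assms by (auto intro: subspace_add tendsto_add)
  then show "x + y \<in> closure S"
    unfolding closure_sequential by (intro exI[of _ "\<lambda>n. f n + g n"]) simp
next
  fix c x assume "x \<in> closure S"
  then obtain f where "\<And>n. f n \<in> S" "f \<longlonglongrightarrow> x"
    unfolding closure_sequential by blast
  then have "\<forall>n. c *\<^sub>R f n \<in> S" "(\<lambda>n. c *\<^sub>R f n) \<longlonglongrightarrow> c *\<^sub>R x"
    using assms by (auto intro: subspace_scale tendsto_intros)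
  then show "c *\<^sub>R x \<in> closure S"
    unfolding closure_sequential by (intro exI[of _ "\<lambda>n. c *\<^sub>R f n"]) simp
qed

text \<open>A closed subset of a complete space is completely metrizable, so the Baire category
  theorem applies inside \<open>Y\<close>. The closures of the \<open>F n\<close> stay in
  \<open>Y\<close> and cover it, hence one of them has nonempty interior relative to
  \<open>Y\<close>, and that interior contains a relative ball.\<close>

lemma Baire_closed_cover:
  fixes Y :: "'a::complete_space set" and F :: "nat \<Rightarrow> 'a set"
  assumes "closed Y" "Y \<noteq> {}" "Y = (\<Union>n. F n)"
  obtains n y r where "y \<in> Y" "r > 0" "Y \<inter> ball y r \<subseteq> closure (F n)"
proof -
  let ?T = "top_of_set Y"
  have comp: "completely_metrizable_space ?T"
    using assms(1)
    by (intro completely_metrizable_space_closedin completely_metrizable_space_euclidean)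
      (simp flip: closed_closedin)
  have sub: "closure (F n) \<subseteq> Y" for n
    using assms by (intro closure_minimal) auto
  have "\<exists>n. ?T interior_of (closure (F n)) \<noteq> {}"
  proof (rule ccontr)
    assume "\<not> ?thesis"
    then have "?T interior_of \<Union>(range (\<lambda>n. closure (F n))) = {}"
      using comp sub
      by (intro Baire_category_alt) (auto intro!: closed_subset)
    moreover have "\<Union>(range (\<lambda>n. closure (F n))) = Y"
      using sub assms(3) closure_subset by blast
    ultimately show False
      using assms(2) by (metis interior_of_topspace topspace_euclidean_subtopology)
  qed
  then obtain n y where "y \<in> ?T interior_of (closure (F n))"
    by blast
  then obtain U where "openin ?T U" "y \<in> U" "U \<subseteq> closure (F n)"
    by (auto simp: interior_of_def)
  moreover from this obtain V where "open V" "U = Y \<inter> V"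
    by (auto simp: openin_open)
  moreover from calculation obtain r where "r > 0" "ball y r \<subseteq> V"
    unfolding open_contains_ball by blast
  ultimately show ?thesis
    by (intro that[of y r n]) auto
qed

text \<open>By Baire, some sublevel set of \<open>p\<close> is dense in a ball of \<open>Y\<close>;
  symmetry and homogeneity move the ball to the origin and rescale it. Every \<open>y\<close> is
  then a series of successive approximations whose \<open>p\<close>-values decay geometrically, and
  countable subadditivity sums them.\<close>

lemma countably_subadditive_bounded:
  fixes p :: "'a::banach \<Rightarrow> real"
  assumes Y: "subspace Y" "closed Y"
    and nonneg: "\<And>y. y \<in> Y \<Longrightarrow> 0 \<le> p y"
    and scale: "\<And>c y. y \<in> Y \<Longrightarrow> p (c *\<^sub>R y) \<le> \<bar>c\<bar> * p y"
    and csub: "\<And>u y. \<lbrakk>\<And>n. u n \<in> Y; u sums y; summable (\<lambda>n. p (u n))\<rbrakk> \<Longrightarrow> p y \<le> (\<Sum>n. p (u n))"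
  shows "\<exists>A\<ge>0. \<forall>y\<in>Y. p y \<le> A * norm y"
proof -
  have Y0: "0 \<in> Y"
    using Y by (simp add: subspace_0)
  have p0: "p 0 = 0"
    using scale[OF Y0, of 0] nonneg[OF Y0] by simp
  have add: "p (a + b) \<le> p a + p b" if "a \<in> Y" "b \<in> Y" for a b
  proof -
    \<comment> \<open>Padding with zeros turns a two-term sum into a series; since
      \<open>p 0 = 0\<close>, countable subadditivity yields the finite one.\<close>
    define u where "u = (\<lambda>n::nat. if n = 0 then a else if n = 1 then b else 0)"
    have "u sums (\<Sum>n\<in>{0,1}. u n)" "(\<lambda>n. p (u n)) sums (\<Sum>n\<in>{0,1}. p (u n))"
      by (rule sums_finite; simp add: u_def p0)+
    moreover have "(\<Sum>n\<in>{0,1}. u n) = a + b" "(\<Sum>n\<in>{0,1}. p (u n)) = p a + p b"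
      by (simp_all add: u_def)
    ultimately have "u sums (a + b)" "(\<lambda>n. p (u n)) sums (p a + p b)"
      by metis+
    then show ?thesis
      using csub[of u "a + b"] that Y0 sums_iff[of "\<lambda>n. p (u n)"] by (auto simp: u_def)
  qed
  obtain N y0 r where y0: "y0 \<in> Y" "r > 0" "Y \<inter> ball y0 r \<subseteq> closure {y \<in> Y. p y \<le> real N}"
  proof (rule Baire_closed_cover[of Y "\<lambda>n. {y \<in> Y. p y \<le> real n}"])
    show "Y = (\<Union>n. {y \<in> Y. p y \<le> real n})"
      using real_arch_simple by auto
  qed (use Y Y0 in auto)
  \<comment> \<open>Recentring at 0: \<open>y\<close> is half the difference of
    \<open>y0 + y\<close> and \<open>y0 - y\<close>, both in the ball around \<open>y0\<close>. If
    \<open>a\<close> and \<open>b\<close> approximate these two points inside the sublevel set, half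
    of \<open>a - b\<close> approximates \<open>y\<close>, and subadditivity and homogeneity keep
    its \<open>p\<close>-value at most \<open>N\<close>.\<close>
  have dense: "\<exists>z\<in>Y. p z \<le> N \<and> norm (y - z) < e" if y: "y \<in> Y" "norm y < r" "e > 0" for y e
  proof -
    have "y0 + y \<in> Y \<inter> ball y0 r" "y0 - y \<in> Y \<inter> ball y0 r"
      using y y0(1) subspace_add[OF Y(1)] subspace_diff[OF Y(1)] by (auto simp: dist_norm)
    then have "y0 + y \<in> closure {y \<in> Y. p y \<le> real N}" "y0 - y \<in> closure {y \<in> Y. p y \<le> real N}"
      using y0(3) by blast+
    then obtain a b where "a \<in> {y \<in> Y. p y \<le> real N}" "dist a (y0 + y) < e"
        "b \<in> {y \<in> Y. p y \<le> real N}" "dist b (y0 - y) < e"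
      using y(3) unfolding closure_approachable by meson
    then have ab: "a \<in> Y" "p a \<le> N" "dist a (y0 + y) < e" "b \<in> Y" "p b \<le> N" "dist b (y0 - y) < e"
      by auto
    define z where "z = (1/2) *\<^sub>R a + (- (1/2)) *\<^sub>R b"
    have "z \<in> Y"
      unfolding z_def using ab Y(1) by (intro subspace_add subspace_scale)
    moreover have "p z \<le> p ((1/2) *\<^sub>R a) + p ((- (1/2)) *\<^sub>R b)"
      unfolding z_def using ab Y by (intro add subspace_scale)
    then have "p z \<le> N"
      using scale[OF ab(1), of "1/2"] scale[OF ab(4), of "- (1/2)"] ab by simp
    moreover have "y - z = (1/2) *\<^sub>R (2 *\<^sub>R y - a + b)"
      by (simp add: z_def scaleR_right_diff_distrib scaleR_right_distrib)
    then have "y - z = (1/2) *\<^sub>R ((y0 + y - a) - (y0 - y - b))"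
      by (simp add: scaleR_2)
    then have "norm (y - z) \<le> (norm (y0 + y - a) + norm (y0 - y - b)) / 2"
      using norm_triangle_ineq4[of "y0 + y - a" "y0 - y - b"] by simp
    then have "norm (y - z) < e"
      using ab by (simp add: dist_norm norm_minus_commute)
    ultimately show ?thesis by blast
  qed
  define M where "M = 2 * N / r"
  have M: "M \<ge> 0"
    using y0 by (simp add: M_def)
  have "\<exists>z\<in>Y. p z \<le> M * s \<and> norm (y - z) \<le> s / 2" if "y \<in> Y" "s > 0" "norm y \<le> s" for y s
  proof -
    \<comment> \<open>Scaling by \<open>c\<close> brings \<open>y\<close> to norm at most
      \<open>r / 2\<close>, strictly inside the ball. Scaling back multiplies the bound
      \<open>N\<close> by \<open>2 * s / r\<close>, which gives \<open>M * s\<close>, and turns the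
      tolerance \<open>c * (s / 2)\<close> into \<open>s / 2\<close>.\<close>
    define c where "c = r / (2 * s)"
    have c: "c > 0"
      using that y0 by (simp add: c_def)
    have "norm (c *\<^sub>R y) \<le> c * s"
      using c that by simp
    also have "\<dots> < r"
      using that y0 by (simp add: c_def)
    finally have "norm (c *\<^sub>R y) < r" .
    moreover have "c *\<^sub>R y \<in> Y" "c * (s / 2) > 0"
      using that c subspace_scale[OF Y(1)] by auto
    ultimately obtain z where z: "z \<in> Y" "p z \<le> N" "norm (c *\<^sub>R y - z) < c * (s / 2)"
      using dense by meson
    have "p (inverse c *\<^sub>R z) \<le> inverse c * N"
      using scale[OF z(1), of "inverse c"] z c
      by (smt (verit) abs_of_pos inverse_positive_iff_positive mult_left_mono)
    then have "p (inverse c *\<^sub>R z) \<le> M * s"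
      by (simp add: c_def M_def field_simps)
    moreover have "c *\<^sub>R y - z = c *\<^sub>R (y - inverse c *\<^sub>R z)"
      using c by (simp add: algebra_simps)
    then have "norm (y - inverse c *\<^sub>R z) \<le> s / 2"
      using z c by simp
    ultimately show ?thesis
      using z Y by (auto intro: subspace_scale)
  qed
  then obtain g where g: "\<And>y s. y \<in> Y \<Longrightarrow> s > 0 \<Longrightarrow> norm y \<le> s \<Longrightarrow>
      g y s \<in> Y \<and> p (g y s) \<le> M * s \<and> norm (y - g y s) \<le> s / 2"
    by metis
  have "p y \<le> (2 * M) * norm y" if y: "y \<in> Y" for y
  proof (cases "y = 0")
    case True
    then show ?thesis by (simp add: p0)
  next
    case False
    \<comment> \<open>Successive approximation: \<open>w n\<close> is the remainder of
      \<open>y\<close> after \<open>n\<close> approximants have been subtracted, and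
      \<open>s n\<close> bounds its norm, halving at each step. The approximants \<open>u n\<close>
      telescope to \<open>y\<close>, with \<open>p (u n)\<close> at most
      \<open>M * s n\<close>.\<close>
    define s where "s = (\<lambda>n::nat. norm y * (1/2) ^ n)"
    define w where "w = rec_nat y (\<lambda>n w. w - g w (s n))"
    have w: "w 0 = y" "w (Suc n) = w n - g (w n) (s n)" for n
      by (simp_all add: w_def)
    have s: "s n > 0" for n
      using False by (simp add: s_def)
    have wY: "w n \<in> Y \<and> norm (w n) \<le> s n" for n
    proof (induction n)
      case 0
      then show ?case using y by (simp add: w s_def)
    next
      case (Suc n)
      then show ?case
        using g[of "w n" "s n"] s[of n] Y by (auto simp: w s_def subspace_diff)
    qed
    define u where "u = (\<lambda>n. g (w n) (s n))"
    have u: "u n \<in> Y" "p (u n) \<le> M * s n" for n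
      using g wY s by (auto simp: u_def)
    have s_sums: "s sums (norm y * 2)"
      using sums_mult[OF geometric_sums[of "1/2::real"], of "norm y"] by (simp add: s_def)
    then have Ms: "(\<lambda>n. M * s n) sums (M * (norm y * 2))"
      by (rule sums_mult)
    have "w \<longlonglongrightarrow> 0"
    proof (rule Lim_null_comparison)
      show "s \<longlonglongrightarrow> 0"
        using s_sums sums_summable summable_LIMSEQ_zero by blast
    qed (use wY in auto)
    then have "(\<lambda>n. w n - w (Suc n)) sums (w 0 - 0)"
      by (rule telescope_sums')
    then have "u sums y"
      by (simp add: w u_def)
    moreover have sp: "summable (\<lambda>n. p (u n))"
      by (rule summable_comparison_test'[OF sums_summable[OF Ms]]) (simp add: u nonneg)
    ultimately have "p y \<le> (\<Sum>n. p (u n))"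
      using u csub by blast
    also have "\<dots> \<le> (\<Sum>n. M * s n)"
      by (rule suminf_le[OF u(2) sp sums_summable[OF Ms]])
    also have "\<dots> = M * (norm y * 2)"
      by (rule sums_unique[OF Ms, symmetric])
    finally show ?thesis by (simp add: mult_ac)
  qed
  then show ?thesis
    using M by (intro exI[of _ "2 * M"]) simp
qed

section \<open>Banach lattices\<close>

lemma norm_abs_eq [simp]:
  fixes x :: "'a::banach_lattice"
  shows "norm \<bar>x\<bar> = norm x"
  by (intro antisym norm_mono_abs) simp_all

lemma norm_mono_nonneg:
  fixes x y :: "'a::banach_lattice"
  assumes "0 \<le> x" "x \<le> y"
  shows "norm x \<le> norm y"
  using assms by (intro norm_mono_abs) (auto simp: abs_of_nonneg)

lemma abs_scaleR_le:
  fixes x :: "'a::banach_lattice"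
  shows "\<bar>c *\<^sub>R x\<bar> \<le> \<bar>c\<bar> *\<^sub>R \<bar>x\<bar>"
proof (cases "c \<ge> 0")
  case True
  have "c *\<^sub>R x \<le> c *\<^sub>R \<bar>x\<bar>" "c *\<^sub>R (- x) \<le> c *\<^sub>R \<bar>x\<bar>"
    using True by (intro scaleR_left_mono; simp add: abs_ge_self abs_ge_minus_self)+
  then show ?thesis
    using True by (intro abs_leI) auto
next
  case False
  have "(- c) *\<^sub>R x \<le> (- c) *\<^sub>R \<bar>x\<bar>" "(- c) *\<^sub>R (- x) \<le> (- c) *\<^sub>R \<bar>x\<bar>"
    using False by (intro scaleR_left_mono; simp add: abs_ge_self abs_ge_minus_self)+
  then show ?thesis
    using False by (intro abs_leI) auto
qed

text \<open>The reverse triangle inequality in the lattice and monotonicity of the norm make the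
  modulus 1-Lipschitz.\<close>

lemma tendsto_abs_lattice:
  fixes f :: "'b \<Rightarrow> 'a::banach_lattice"
  assumes "(f \<longlongrightarrow> l) F"
  shows "((\<lambda>x. \<bar>f x\<bar>) \<longlongrightarrow> \<bar>l\<bar>) F"
proof -
  have "((\<lambda>x. \<bar>f x\<bar> - \<bar>l\<bar>) \<longlongrightarrow> 0) F"
  proof (rule Lim_null_comparison)
    show "\<forall>\<^sub>F x in F. norm (\<bar>f x\<bar> - \<bar>l\<bar>) \<le> norm (f x - l)"
      by (intro always_eventually allI norm_mono_abs abs_triangle_ineq3)
    show "((\<lambda>x. norm (f x - l)) \<longlongrightarrow> 0) F"
      using assms tendsto_norm_zero LIM_zero by blast
  qed
  then show ?thesis
    by (rule LIM_zero_cancel)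
qed

text \<open>The positive cone is the fixed-point set of the continuous map taking \<open>x\<close>
  to its modulus.\<close>

lemma closed_nonneg_lattice: "closed {x::'a::banach_lattice. 0 \<le> x}"
  unfolding closed_sequential_limits
proof (intro allI impI)
  fix f and l :: 'a
  assume f: "(\<forall>n. f n \<in> {x. 0 \<le> x}) \<and> f \<longlonglongrightarrow> l"
  then have "f \<longlonglongrightarrow> \<bar>l\<bar>"
    using tendsto_abs_lattice[of f l] by (simp add: abs_of_nonneg)
  then have "l = \<bar>l\<bar>"
    using f LIMSEQ_unique by blast
  then show "l \<in> {x. 0 \<le> x}"
    by (metis abs_ge_zero mem_Collect_eq)
qed

text \<open>The difference of the two sides is a limit of finite sums of nonnegative terms, so it
  lies in the closed positive cone.\<close>

lemma sum_le_suminf_lattice: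
  fixes f :: "nat \<Rightarrow> 'a::banach_lattice"
  assumes "summable f" "\<And>k. 0 \<le> f k"
  shows "(\<Sum>k<m. f k) \<le> suminf f"
proof -
  have "(\<Sum>k<n. f (k + m)) \<in> {x. 0 \<le> x}" for n
    using assms by (auto intro: sum_nonneg)
  moreover have "(\<lambda>n. \<Sum>k<n. f (k + m)) \<longlonglongrightarrow> suminf f - (\<Sum>k<m. f k)"
    using summable_sums[OF assms(1)] sums_iff_shift'[of f m] by (simp add: sums_def)
  ultimately have "suminf f - (\<Sum>k<m. f k) \<in> {x. 0 \<le> x}"
    by (rule closed_sequentially[OF closed_nonneg_lattice])
  then show ?thesis by simp
qed

section \<open>Absolute decompositions\<close>

text \<open>The absoluteness inequality, applied to blocks \<open>m..<n\<close>, carries the Cauchy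
  criterion from \<open>x\<close> over to its moduli.\<close>

lemma absolute_summable_abs:
  assumes "absolute_decomposition X" "\<And>k. 0 \<in> X k" "\<And>k. x k \<in> X k" "summable x"
  shows "summable (\<lambda>k. \<bar>x k\<bar>)"
proof -
  obtain A where A: "A \<ge> 1"
    "\<And>m x. (\<And>k. k < m \<Longrightarrow> x k \<in> X k) \<Longrightarrow> norm (\<Sum>k<m. \<bar>x k\<bar>) \<le> A * norm (\<Sum>k<m. x k)"
    using assms(1) unfolding absolute_decomposition_def by blast
  have le: "norm (\<Sum>k=m..<n. \<bar>x k\<bar>) \<le> A * norm (\<Sum>k=m..<n. x k)" for m n
  proof -
    \<comment> \<open>Absoluteness speaks of initial segments only; replacing the terms outside the
      block by 0, which lies in every \<open>X k\<close>, gives the inequality for the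
      block.\<close>
    let ?z = "\<lambda>k. if k \<in> {m..<n} then x k else 0"
    have "norm (\<Sum>k<n. \<bar>?z k\<bar>) \<le> A * norm (\<Sum>k<n. ?z k)"
      using assms by (intro A(2)) auto
    moreover have "(\<Sum>k<n. ?z k) = (\<Sum>k=m..<n. x k)" "(\<Sum>k<n. \<bar>?z k\<bar>) = (\<Sum>k=m..<n. \<bar>x k\<bar>)"
      by (intro sum.mono_neutral_cong_right; auto)+
    ultimately show ?thesis by simp
  qed
  show ?thesis
    unfolding summable_Cauchy
  proof (intro allI impI)
    fix e :: real assume "e > 0"
    then have "e / A > 0"
      using A by simp
    then obtain N where "\<forall>m\<ge>N. \<forall>n. norm (sum x {m..<n}) < e / A"
      using assms(4) unfolding summable_Cauchy by blast
    then have "\<forall>m\<ge>N. \<forall>n. norm (\<Sum>k=m..<n. \<bar>x k\<bar>) < e"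
      using le A by (smt (verit) mult.commute pos_less_divide_eq)
    then show "\<exists>N. \<forall>m\<ge>N. \<forall>n. norm (\<Sum>k=m..<n. \<bar>x k\<bar>) < e" ..
  qed
qed

lemma bounded_imp_absolute:
  fixes X :: "nat \<Rightarrow> 'a::banach_lattice set"
  assumes sub: "\<And>k. subspace (X k)"
    and cl: "\<And>k. closed (X k)"
    and schauder: "schauder_decomposition X (closed_linear_span X)"
    and bdd: "\<And>x. (\<And>k. x k \<in> X k) \<Longrightarrow> summable x \<Longrightarrow> bounded (range (\<lambda>m. \<Sum>k<m. \<bar>x k\<bar>))"
  shows "absolute_decomposition X"
proof -
  define Y where "Y = closed_linear_span X"
  have Y: "subspace Y" "closed Y"
    unfolding Y_def closed_linear_span_def by (auto intro: subspace_closure)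
  have XY: "X k \<subseteq> Y" for k
    unfolding Y_def closed_linear_span_def
    by (meson UN_upper UNIV_I closure_subset order_trans span_superset)
  \<comment> \<open>The coordinate sequence of \<open>y\<close>; the description is meaningful for
    \<open>y\<close> in \<open>Y\<close>, where the expansion exists and is unique.\<close>
  define c where "c y = (THE x. (\<forall>k. x k \<in> X k) \<and> x sums y)" for y
  have ex1: "\<exists>!x. (\<forall>k. x k \<in> X k) \<and> x sums y" if "y \<in> Y" for y
    using schauder that by (auto simp: schauder_decomposition_def Y_def)
  have c: "c y k \<in> X k" "c y sums y" if "y \<in> Y" for y k
    using theI'[OF ex1[OF that]] by (auto simp: c_def)
  have c_unique: "c y = x" if "y \<in> Y" "\<And>k. x k \<in> X k" "x sums y" for x y
    using ex1 c that by blast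
  define q where "q y m = norm (\<Sum>k<m. \<bar>c y k\<bar>)" for y m
  define p where "p y = (SUP m. q y m)" for y
  \<comment> \<open>Here the boundedness hypothesis enters: it makes the real supremum
    \<open>p y\<close> an actual upper bound of all \<open>q y m\<close>.\<close>
  have bdd_q: "bdd_above (range (q y))" if "y \<in> Y" for y
  proof -
    have "bounded (range (\<lambda>m. \<Sum>k<m. \<bar>c y k\<bar>))"
      using c[OF that] by (intro bdd) (auto simp: sums_iff)
    then show ?thesis
      by (auto simp: bounded_iff q_def intro: bdd_aboveI)
  qed
  have q_le: "q y m \<le> p y" if "y \<in> Y" for y m
    unfolding p_def using bdd_q[OF that] by (intro cSUP_upper) auto
  have p_le: "p y \<le> B" if "\<And>m. q y m \<le> B" for y B
    unfolding p_def using that by (intro cSUP_least) auto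
  \<comment> \<open>This bound and \<open>coord_le\<close> do the work of continuity of the
    coordinate maps: control of \<open>p\<close> gives control of all partial sums, uniformly in
    \<open>m\<close>, and of each coordinate.\<close>
  have partial_le: "norm (\<Sum>k<m. c y k) \<le> p y" if "y \<in> Y" for y m
  proof -
    have "norm (\<Sum>k<m. c y k) \<le> q y m"
      unfolding q_def by (intro norm_mono_abs) (simp add: sum_abs)
    then show ?thesis
      using q_le[OF that, of m] by simp
  qed
  have coord_le: "norm (c y k) \<le> p y" if "y \<in> Y" for y k
  proof -
    have "norm \<bar>c y k\<bar> \<le> q y (Suc k)"
      unfolding q_def by (intro norm_mono_nonneg) (auto intro!: member_le_sum sum_nonneg)
    then show ?thesis
      using q_le[OF that, of "Suc k"] by simp
  qed
  have "\<exists>A\<ge>0. \<forall>y\<in>Y. p y \<le> A * norm y"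
  proof (rule countably_subadditive_bounded[OF Y, of p])
    show "0 \<le> p y" if "y \<in> Y" for y
      using q_le[OF that, of 0] by (simp add: q_def)
  next
    fix a :: real and y assume y: "y \<in> Y"
    have c_scale: "c (a *\<^sub>R y) = (\<lambda>k. a *\<^sub>R c y k)"
      using y c Y sub by (intro c_unique) (auto intro: subspace_scale sums_scaleR_right)
    have "q (a *\<^sub>R y) m \<le> \<bar>a\<bar> * p y" for m
    proof -
      have "(\<Sum>k<m. \<bar>a *\<^sub>R c y k\<bar>) \<le> (\<Sum>k<m. \<bar>a\<bar> *\<^sub>R \<bar>c y k\<bar>)"
        by (intro sum_mono abs_scaleR_le)
      then have "norm (\<Sum>k<m. \<bar>a *\<^sub>R c y k\<bar>) \<le> norm (\<bar>a\<bar> *\<^sub>R (\<Sum>k<m. \<bar>c y k\<bar>))"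
        by (intro norm_mono_nonneg) (auto intro: sum_nonneg simp: scaleR_sum_right)
      also have "\<dots> = \<bar>a\<bar> * q y m"
        by (simp add: q_def)
      also have "\<dots> \<le> \<bar>a\<bar> * p y"
        using q_le[OF y] by (intro mult_left_mono) auto
      finally show ?thesis
        by (simp add: q_def c_scale)
    qed
    then show "p (a *\<^sub>R y) \<le> \<bar>a\<bar> * p y"
      by (rule p_le)
  next
    fix u y assume u: "\<And>n. u n \<in> Y" "u sums y" and sp: "summable (\<lambda>n. p (u n))"
    have "(\<Sum>i<n. u i) \<in> Y" for n
      using u(1) by (intro subspace_sum[OF Y(1)])
    then have y: "y \<in> Y"
      using u(2) unfolding sums_def by (rule closed_sequentially[OF Y(2)])
    \<comment> \<open>The candidate expansion of \<open>y\<close> is found by adding the expansions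
      of the \<open>u n\<close> coordinatewise.\<close>
    define d where "d k = (\<Sum>n. c (u n) k)" for k
    have sc: "summable (\<lambda>n. c (u n) k)" for k
      by (rule summable_comparison_test'[OF sp]) (rule coord_le[OF u(1)])
    \<comment> \<open>Two limits are interchanged: \<open>m\<close>, along the expansions, and
      \<open>N\<close>, along the series of the \<open>u n\<close>. The M-test with majorants
      \<open>p (u n)\<close> makes the limit in \<open>N\<close> uniform in
      \<open>m\<close>.\<close>
    have "d sums y"
      unfolding sums_def
    proof (rule swap_uniform_limit')
      show "\<forall>\<^sub>F N in sequentially. (\<lambda>m. \<Sum>n<N. \<Sum>k<m. c (u n) k) \<longlonglongrightarrow> (\<Sum>n<N. u n)"
        using c(2)[OF u(1)] unfolding sums_def by (intro always_eventually allI tendsto_sum)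
      show "(\<lambda>N. \<Sum>n<N. u n) \<longlonglongrightarrow> y"
        using u by (simp add: sums_def)
      have "uniform_limit UNIV (\<lambda>N m. \<Sum>n<N. \<Sum>k<m. c (u n) k)
          (\<lambda>m. \<Sum>n. \<Sum>k<m. c (u n) k) sequentially"
        using partial_le[OF u(1)] sp by (intro Weierstrass_m_test) auto
      then show "uniform_limit UNIV (\<lambda>N m. \<Sum>n<N. \<Sum>k<m. c (u n) k)
          (\<lambda>m. \<Sum>k<m. d k) sequentially"
        using sc by (simp add: d_def suminf_sum)
    qed auto
    moreover have "d k \<in> X k" for k
    proof (rule closed_sequentially[OF cl])
      show "(\<Sum>n<N. c (u n) k) \<in> X k" for N
        using c(1)[OF u(1)] by (intro subspace_sum[OF sub])
      show "(\<lambda>N. \<Sum>n<N. c (u n) k) \<longlonglongrightarrow> d k"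
        unfolding d_def by (rule summable_LIMSEQ[OF sc])
    qed
    \<comment> \<open>Closedness of each \<open>X k\<close> puts \<open>d k\<close> in
      \<open>X k\<close>, so uniqueness of expansions identifies \<open>d\<close> with the
      coordinates of \<open>y\<close>.\<close>
    ultimately have cd: "c y = d"
      using y by (intro c_unique)
    \<comment> \<open>For fixed \<open>m\<close>, continuity of the modulus makes
      \<open>q y m\<close> a limit in \<open>N\<close>. Each term of that limit involves only finite
      sums, where the triangle inequality and an exchange of summation give the bound.\<close>
    have "q y m \<le> (\<Sum>n. p (u n))" for m
    proof (rule LIMSEQ_le_const2)
      show "(\<lambda>N. norm (\<Sum>k<m. \<bar>\<Sum>n<N. c (u n) k\<bar>)) \<longlonglongrightarrow> q y m"
        unfolding q_def cd d_def
        by (intro tendsto_norm tendsto_sum tendsto_abs_lattice summable_LIMSEQ sc)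
      have "norm (\<Sum>k<m. \<bar>\<Sum>n<N. c (u n) k\<bar>) \<le> (\<Sum>n. p (u n))" for N
      proof -
        have "(\<Sum>k<m. \<bar>\<Sum>n<N. c (u n) k\<bar>) \<le> (\<Sum>k<m. \<Sum>n<N. \<bar>c (u n) k\<bar>)"
          by (intro sum_mono sum_abs)
        also have "\<dots> = (\<Sum>n<N. \<Sum>k<m. \<bar>c (u n) k\<bar>)"
          by (rule sum.swap)
        finally have "norm (\<Sum>k<m. \<bar>\<Sum>n<N. c (u n) k\<bar>) \<le> norm (\<Sum>n<N. \<Sum>k<m. \<bar>c (u n) k\<bar>)"
          by (intro norm_mono_nonneg) (auto intro: sum_nonneg)
        also have "\<dots> \<le> (\<Sum>n<N. p (u n))"
          using q_le[OF u(1)] by (intro sum_norm_le) (auto simp: q_def)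
        also have "\<dots> \<le> (\<Sum>n. p (u n))"
          using sp q_le[OF u(1), of _ 0] by (intro sum_le_suminf) (auto simp: q_def)
        finally show ?thesis .
      qed
      then show "\<exists>M. \<forall>N\<ge>M. norm (\<Sum>k<m. \<bar>\<Sum>n<N. c (u n) k\<bar>) \<le> (\<Sum>n. p (u n))"
        by blast
    qed
    then show "p y \<le> (\<Sum>n. p (u n))"
      by (rule p_le)
  qed
  then obtain A where A: "A \<ge> 0" "\<And>y. y \<in> Y \<Longrightarrow> p y \<le> A * norm y"
    by blast
  have "norm (\<Sum>k<m. \<bar>x k\<bar>) \<le> (1 + A) * norm (\<Sum>k<m. x k)" if x: "\<And>k. k < m \<Longrightarrow> x k \<in> X k" for m x
  proof -
    define y where "y = (\<Sum>k<m. x k)"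
    have y: "y \<in> Y"
      unfolding y_def using x XY Y by (intro subspace_sum) auto
    \<comment> \<open>Extending \<open>x\<close> by zeros beyond \<open>m\<close> gives an expansion
      of the finite sum \<open>y\<close>, which is the only one by uniqueness.\<close>
    have "c y = (\<lambda>k. if k \<in> {..<m} then x k else 0)"
      using x y sub sums_If_finite_set[of "{..<m}" x]
      by (intro c_unique) (auto simp: y_def subspace_0)
    then have "norm (\<Sum>k<m. \<bar>x k\<bar>) = q y m"
      by (simp add: q_def)
    also have "\<dots> \<le> A * norm y"
      using q_le[OF y, of m] A(2)[OF y] by simp
    \<comment> \<open>Passing from \<open>A\<close> to \<open>1 + A\<close> secures the requirement
      that the constant be at least 1.\<close>
    also have "\<dots> \<le> (1 + A) * norm y"
      by (intro mult_right_mono) auto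
    finally show ?thesis
      by (simp add: y_def)
  qed
  then show ?thesis
    unfolding absolute_decomposition_def using A(1) by (intro exI[of _ "1 + A"]) auto
qed

theorem theorem7p2:
  fixes X :: "nat \<Rightarrow> 'a::banach_lattice set"
  assumes "\<And>k. subspace (X k)"
    and "\<And>k. closed (X k)"
    and "\<And>k. X k \<noteq> {0}"
    and "schauder_decomposition X (closed_linear_span X)"
  defines "C1 \<equiv> absolute_decomposition X"
    and "C2 \<equiv> \<forall>x. (\<forall>k. x k \<in> X k) \<longrightarrow> summable x \<longrightarrow> summable (\<lambda>k. \<bar>x k\<bar>)"
    and "C3 \<equiv> \<forall>x. (\<forall>k. x k \<in> X k) \<longrightarrow> summable x \<longrightarrow>
                 order_bounded (range (\<lambda>m. \<Sum>k<m. \<bar>x k\<bar>))"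
    and "C4 \<equiv> \<forall>x. (\<forall>k. x k \<in> X k) \<longrightarrow> summable x \<longrightarrow>
                 bounded (range (\<lambda>m. \<Sum>k<m. \<bar>x k\<bar>))"
  shows "(C1 \<longleftrightarrow> C2) \<and> (C2 \<longleftrightarrow> C3) \<and> (C3 \<longleftrightarrow> C4)"
proof -
  have "C1 \<Longrightarrow> C2"
    unfolding C1_def C2_def using assms(1)
    by (auto intro: absolute_summable_abs subspace_0)
  \<comment> \<open>The order interval runs from 0 to the sum of the series of moduli.\<close>
  moreover have "order_bounded (range (\<lambda>m. \<Sum>k<m. \<bar>x k\<bar>))" if "summable (\<lambda>k. \<bar>x k\<bar>)" for x :: "nat \<Rightarrow> 'a"
    unfolding order_bounded_def using sum_le_suminf_lattice[OF that]
    by (intro exI[of _ 0] exI[of _ "\<Sum>k. \<bar>x k\<bar>"]) (auto intro: sum_nonneg)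
  then have "C2 \<Longrightarrow> C3"
    unfolding C2_def C3_def by blast
  moreover have "bounded (range (\<lambda>m. \<Sum>k<m. \<bar>x k\<bar>))"
    if bd: "order_bounded (range (\<lambda>m. \<Sum>k<m. \<bar>x k\<bar>))" for x :: "nat \<Rightarrow> 'a"
  proof -
    obtain a b where "range (\<lambda>m. \<Sum>k<m. \<bar>x k\<bar>) \<subseteq> {a..b}"
      using bd unfolding order_bounded_def by blast
    then have "(\<Sum>k<m. \<bar>x k\<bar>) \<le> b" for m
      by (auto simp: image_subset_iff)
    \<comment> \<open>The partial sums lie between 0 and \<open>b\<close>, so monotonicity of the
      lattice norm turns the order bound into a norm bound.\<close>
    then have "norm (\<Sum>k<m. \<bar>x k\<bar>) \<le> norm b" for m
      by (intro norm_mono_nonneg) (auto intro: sum_nonneg)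
    then show ?thesis
      by (auto simp: bounded_iff)
  qed
  then have "C3 \<Longrightarrow> C4"
    unfolding C3_def C4_def by blast
  moreover have "C4 \<Longrightarrow> C1"
    unfolding C1_def C4_def using assms(1,2,4) by (intro bounded_imp_absolute) auto
  ultimately show ?thesis by blast
qed

end
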